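(* For any fixed $\omega \in \mathbb{R}$, if $0 \notin K^n(j\omega)$, then $$\min\Big\{ \Re \frac{g(j\omega)}{f(j\omega)} \;:\; g(s)\in K^m(s),\ f(s)\in K^n(s) \Big\} > 0$$ if and only if $$\min\Big\{ \Re \frac{g_{i_1 j_1}(j\omega)}{f_{i_2 j_2}(j\omega)} \;:\; (i_1\, j_1\, i_2\, j_2) \in I_2 \Big\} > 0 .$$
   Context: $j$ (not as a subscript) is the imaginary unit. Let $m\le n$, and let real numbers $a_i^-\le a_i^+$ ($0\le i\le m$), $b_i^-\le b_i^+$ ($0\le i\le n$) be given. The $m$-th and $n$-th order real interval polynomials are $$K^m(s)=\Big\{\sum_{i=0}^m a_i s^i : a_i\in[a_i^-,a_i^+]\Big\},\qquad K^n(s)=\Big\{\sum_{i=0}^n b_i s^i : b_i\in[b_i^-,b_i^+]\Big\},$$ and $K^n(j\omega)=\{f(j\omega): f\in K^n(s)\}$. Define (sums truncated at degree $m$) $\alpha_g^{(1)}(s^2)=a_0^-+a_2^+s^2+a_4^-s^4+a_6^+s^6+\cdots$, $\alpha_g^{(2)}(s^2)=a_0^++a_2^-s^2+a_4^+s^4+a_6^-s^6+\cdots$, $\beta_g^{(1)}(s^2)=a_1^-+a_3^+s^2+a_5^-s^4+a_7^+s^6+\cdots$, $\beta_g^{(2)}(s^2)=a_1^++a_3^-s^2+a_5^+s^4+a_7^-s^6+\cdots$, and $g_{ik}(s)=\alpha_g^{(i)}(s^2)+s\,\beta_g^{(k)}(s^2)\in K^m(s)$ for $i,k\in\{1,2\}$.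 The polynomials $f_{ik}(s)\in K^n(s)$ are defined in the same way from the bounds $b_i^\pm$. The index set is $I_2=\{(1112),(1222),(2111),(2221),(1121),(1211),(2122),(2212)\}$, where $(i_1\,j_1\,i_2\,j_2)$ is a 4-tuple with entries in $\{1,2\}$. *)

theory Defs
  imports Complex_Main "HOL-Computational_Algebra.Polynomial"
begin

text \<open>Polynomials of formal degree \<open>d\<close>: as in the usual convention for interval
  polynomials, the leading coefficient is allowed to vanish.\<close>

definition interval_polys :: "(nat \<Rightarrow> real) \<Rightarrow> (nat \<Rightarrow> real) \<Rightarrow> nat \<Rightarrow> real poly set" where
  "interval_polys lo hi d = {\<Sum>i\<le>d. monom (c i) i | c. \<forall>i\<le>d. c i \<in> {lo i..hi i}}"

definition eval_jw :: "real poly \<Rightarrow> real \<Rightarrow> complex" where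
  "eval_jw p \<omega> = poly (map_poly complex_of_real p) (\<i> * complex_of_real \<omega>)"

text \<open>\<open>alpha_poly\<close> and \<open>beta_poly\<close> are polynomials in the variable \<open>s\<^sup>2\<close>. The bounds alternate along
  their coefficients, starting with the lower one for \<open>i = 1\<close> and with the upper one for \<open>i = 2\<close>;
  no other values of \<open>i\<close> are meaningful.\<close>

definition bound_alt :: "(nat \<Rightarrow> real) \<Rightarrow> (nat \<Rightarrow> real) \<Rightarrow> nat \<Rightarrow> nat \<Rightarrow> nat \<Rightarrow> real" where
  "bound_alt lo hi i l = (if even l \<longleftrightarrow> i = 1 then lo else hi)"

definition alpha_poly :: "(nat \<Rightarrow> real) \<Rightarrow> (nat \<Rightarrow> real) \<Rightarrow> nat \<Rightarrow> nat \<Rightarrow> real poly" where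
  "alpha_poly lo hi d i = (\<Sum>l | 2 * l \<le> d. monom (bound_alt lo hi i l (2 * l)) l)"

definition beta_poly :: "(nat \<Rightarrow> real) \<Rightarrow> (nat \<Rightarrow> real) \<Rightarrow> nat \<Rightarrow> nat \<Rightarrow> real poly" where
  "beta_poly lo hi d k = (\<Sum>l | 2 * l + 1 \<le> d. monom (bound_alt lo hi k l (2 * l + 1)) l)"

definition kharitonov_poly :: "(nat \<Rightarrow> real) \<Rightarrow> (nat \<Rightarrow> real) \<Rightarrow> nat \<Rightarrow> nat \<Rightarrow> nat \<Rightarrow> real poly" where
  "kharitonov_poly lo hi d i k =
     pcompose (alpha_poly lo hi d i) (monom 1 2) + monom 1 1 * pcompose (beta_poly lo hi d k) (monom 1 2)"

definition I2 :: "(nat \<times> nat \<times> nat \<times> nat) set" where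
  "I2 = {(1,1,1,2), (1,2,2,2), (2,1,1,1), (2,2,2,1), (1,1,2,1), (1,2,1,1), (2,1,2,2), (2,2,1,2)}"

lemma pcompose_monom_monom: "pcompose (monom (c :: real) l) (monom 1 2) = monom c (2 * l)"
  by (simp add: poly_eq_poly_eq_iff [symmetric] fun_eq_iff poly_pcompose poly_monom power_mult)

lemma kharitonov_poly_in_interval_polys:
  assumes "\<forall>i\<le>d. lo i \<le> hi i"
  shows "kharitonov_poly lo hi d i k \<in> interval_polys lo hi d"
proof -
  define c where
    "c r = (if even r then bound_alt lo hi i (r div 2) r else bound_alt lo hi k (r div 2) r)" for r
  have ev: "pcompose (alpha_poly lo hi d i) (monom 1 2) = (\<Sum>r | r \<le> d \<and> even r. monom (c r) r)"
    unfolding alpha_poly_def pcompose_sum pcompose_monom_monom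
    by (rule sum.reindex_bij_witness [of _ "\<lambda>r. r div 2" "\<lambda>l. 2 * l"]) (auto simp: c_def)
  have od: "monom 1 1 * pcompose (beta_poly lo hi d k) (monom 1 2) =
      (\<Sum>r | r \<le> d \<and> odd r. monom (c r) r)"
    unfolding beta_poly_def pcompose_sum pcompose_monom_monom sum_distrib_left
    by (rule sum.reindex_bij_witness [of _ "\<lambda>r. r div 2" "\<lambda>l. 2 * l + 1"])
      (auto simp: c_def mult_monom)
  have "kharitonov_poly lo hi d i k = (\<Sum>r\<in>{r. r \<le> d \<and> even r} \<union> {r. r \<le> d \<and> odd r}. monom (c r) r)"
    unfolding kharitonov_poly_def ev od by (rule sum.union_disjoint [symmetric]) auto
  also have "{r. r \<le> d \<and> even r} \<union> {r. r \<le> d \<and> odd r} = {..d}" by auto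
  finally show ?thesis
    using assms unfolding interval_polys_def by (auto simp: c_def bound_alt_def)
qed

end

theory Submission
  imports Defs "HOL-Analysis.Analysis"
begin

text \<open>
  Off the origin, \<open>Re (g / f)\<close> has the sign of the real inner product \<open>g \<bullet> f\<close> of the two plane
  vectors. At \<open>s = \<i>\<omega>\<close> the even coefficients of a polynomial contribute only to the real part of its
  value and the odd ones only to the imaginary part, and the signs of \<open>\<i>\<^sup>r\<close> alternate along each
  of them. Hence, for \<open>\<omega> \<ge> 0\<close>, the values of an interval polynomial fill an axis-parallel
  rectangle whose corners are the values of the four Kharitonov polynomials
  (\<open>eval_jw_interval_polys\<close>). Negative frequencies only conjugate \<open>g\<close> and \<open>f\<close>, which leaves
  \<open>Re (g / f)\<close> unchanged. The rectangles are compact, so the minimum exists, and the theorem becomes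
  a statement on two rectangles \<open>G\<close> and \<open>F\<close> with \<open>0 \<notin> F\<close>: the inner product is positive on
  \<open>G \<times> F\<close> if it is positive at the eight pairs of corners listed in \<open>I2\<close>
  (\<open>inner_pos_of_I2_pairs\<close>).

  A rectangle \<open>F\<close> that avoids the origin lies in an open half-plane bounded by a coordinate axis.
  The list \<open>I2\<close> is invariant under a simultaneous quarter turn of \<open>G\<close> and \<open>F\<close>, and so is
  the inner product; one may therefore suppose that \<open>F\<close> lies in the right half-plane. There the
  smallest inner product with a given \<open>f\<close> is attained at the lower left corner of \<open>G\<close> if \<open>f\<close> is in
  the first quadrant, and at the upper left corner if \<open>f\<close> is in the fourth. Positivity of the inner
  product with a fixed corner of \<open>G\<close> depends only on the direction of \<open>f\<close> and holds on a convex cone,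
  so it is enough to test it at the two extreme directions of \<open>F\<close> within the quadrant. These are
  directions of corners of \<open>F\<close>, or, if \<open>F\<close> meets the real axis, that of the axis itself; the
  corresponding pairs of corners belong to \<open>I2\<close>, and positivity on the axis follows from them.
\<close>

section \<open>Two rectangles in the plane\<close>

text \<open>
  The part of the rectangle \<open>{u1..u2} \<times> {v1..v2}\<close> in the closed first quadrant is seen from the
  origin between the directions of \<open>(u1, v2)\<close> and of \<open>(u2, v1)\<close>, the latter being replaced by the
  real axis if \<open>v1 < 0\<close>. The two inequalities test \<open>(x, y)\<close> on these extreme directions; on the
  real axis the test is \<open>0 < x\<close>.
\<close>

lemma inner_pos_first_quadrant:
  fixes x y u v u1 u2 v1 v2 :: real
  assumes "0 < u1" "u1 \<le> u" "u \<le> u2" "v1 \<le> v" "v \<le> v2" "0 \<le> v"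
    and upper: "x * u1 + y * v2 > 0"
    and lower: "0 \<le> v1 \<and> x * u2 + y * v1 > 0 \<or> x > 0"
  shows "x * u + y * v > 0"
proof (cases "x > 0")
  case True
  show ?thesis
  proof (cases "y \<ge> 0")
    case True
    have "0 < x * u" using \<open>x > 0\<close> assms by simp
    moreover have "0 \<le> y * v" using True assms by simp
    ultimately show ?thesis by linarith
  next
    case False
    have "x * u1 \<le> x * u" using \<open>x > 0\<close> assms by simp
    moreover have "y * v2 \<le> y * v" using False assms by (intro mult_left_mono_neg) auto
    ultimately show ?thesis using upper by linarith
  qed
next
  case False
  hence "x * u1 \<le> 0" using assms by (simp add: mult_nonpos_nonneg)
  hence "y * v2 > 0" using upper by linarith
  hence "y > 0" using assms by (simp add: zero_less_mult_iff)
  hence "y * v1 \<le> y * v" using assms by simp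
  moreover have "x * u2 \<le> x * u" using False assms by (intro mult_left_mono_neg) auto
  ultimately show ?thesis using lower False by linarith
qed

text \<open>The fourth quadrant is the first one after reflection in the real axis.\<close>

lemma inner_pos_right_half_plane:
  fixes x y u v x1 y1 y2 u1 u2 v1 v2 :: real
  assumes "x1 \<le> x" "y1 \<le> y" "y \<le> y2" "u1 \<le> u" "u \<le> u2" "v1 \<le> v" "v \<le> v2"
    and "0 < u1"
    and "x1 * u1 + y1 * v2 > 0" "x1 * u2 + y1 * v1 > 0"
    and "x1 * u1 + y2 * v1 > 0" "x1 * u2 + y2 * v2 > 0"
  shows "x * u + y * v > 0"
proof -
  \<comment> \<open>Were \<open>x1 \<le> 0\<close>, both \<open>y1 * v2\<close> and \<open>y2 * v1\<close> would be positive, so that \<open>y2 < 0 < y1\<close>.\<close>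
  have axis: "x1 > 0" if "v1 < 0" "0 \<le> v2"
  proof (rule ccontr)
    assume "\<not> x1 > 0"
    hence "x1 * u1 \<le> 0" using assms by (simp add: mult_nonpos_nonneg)
    hence "y1 * v2 > 0" "y2 * v1 > 0" using assms by linarith+
    hence "y1 > 0" "y2 < 0" using that by (auto simp: zero_less_mult_iff)
    thus False using assms by linarith
  qed
  have *: "x1 * u \<le> x * u" using assms by (simp add: mult_right_mono)
  show ?thesis
  proof (cases "v \<ge> 0")
    case True
    have "x1 * u + y1 * v > 0"
      by (rule inner_pos_first_quadrant[of u1 u u2 v1 v v2])
        (use assms True axis in force)+
    moreover have "y1 * v \<le> y * v" using assms True by (simp add: mult_right_mono)
    ultimately show ?thesis using * by linarith
  next
    case False
    have "x1 * u + (- y2) * (- v) > 0"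
      by (rule inner_pos_first_quadrant[of u1 u u2 "- v2" "- v" "- v1"])
        (use assms False axis in force)+
    moreover have "y2 * v \<le> y * v" using assms False by (simp add: mult_right_mono_neg)
    ultimately show ?thesis using * by linarith
  qed
qed

text \<open>The sides of the rectangles are given by sequences, whose values at 1 and 2 are the ends, so that
  the entries of \<open>I2\<close> can index the corners directly.\<close>

lemma inner_pos_of_I2_pairs:
  fixes x y u v :: "nat \<Rightarrow> real"
  assumes I2: "\<And>i1 j1 i2 j2. (i1, j1, i2, j2) \<in> I2 \<Longrightarrow> x i1 * u i2 + y j1 * v j2 > 0"
    and avoid: "0 < u 1 \<or> u 2 < 0 \<or> 0 < v 1 \<or> v 2 < 0"
    and box: "X \<in> {x 1..x 2}" "Y \<in> {y 1..y 2}" "U \<in> {u 1..u 2}" "V \<in> {v 1..v 2}"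
  shows "X * U + Y * V > 0"
proof -
  have p: "x 1 * u 1 + y 1 * v 2 > 0" "x 1 * u 2 + y 2 * v 2 > 0"
    "x 2 * u 1 + y 1 * v 1 > 0" "x 2 * u 2 + y 2 * v 1 > 0"
    "x 1 * u 2 + y 1 * v 1 > 0" "x 1 * u 1 + y 2 * v 1 > 0"
    "x 2 * u 2 + y 1 * v 2 > 0" "x 2 * u 1 + y 2 * v 2 > 0"
    by (rule I2; simp add: I2_def)+
  \<comment> \<open>The other three cases are turned into the first by the half turn, by the quarter turn
    \<open>(x, y) \<mapsto> (y, - x)\<close> and by its inverse, respectively.\<close>
  consider "0 < u 1" | "u 2 < 0" | "0 < v 1" | "v 2 < 0" using avoid by blast
  thus ?thesis
  proof cases
    case 1
    show ?thesis
      by (rule inner_pos_right_half_plane[of "x 1" _ "y 1" _ "y 2" "u 1" _ "u 2" "v 1" _ "v 2"])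
        (use p box 1 in auto)
  next
    case 2
    have "(- X) * (- U) + (- Y) * (- V) > 0"
      by (rule inner_pos_right_half_plane
          [of "- x 2" _ "- y 2" _ "- y 1" "- u 2" _ "- u 1" "- v 2" _ "- v 1"])
        (use p box 2 in auto)
    thus ?thesis by simp
  next
    case 3
    have "Y * V + (- X) * (- U) > 0"
      by (rule inner_pos_right_half_plane
          [of "y 1" _ "- x 2" _ "- x 1" "v 1" _ "v 2" "- u 2" _ "- u 1"])
        (use p box 3 in \<open>auto simp: add.commute\<close>)
    thus ?thesis by simp
  next
    case 4
    have "(- Y) * (- V) + X * U > 0"
      by (rule inner_pos_right_half_plane
          [of "- y 2" _ "x 1" _ "x 2" "- v 2" _ "- v 1" "u 1" _ "u 2"])
        (use p box 4 in \<open>auto simp: add.commute\<close>)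
    thus ?thesis by simp
  qed
qed

lemma Re_divide_pos_iff:
  fixes g f :: complex
  assumes "f \<noteq> 0"
  shows "Re (g / f) > 0 \<longleftrightarrow> Re g * Re f + Im g * Im f > 0"
proof -
  have "(Re f)\<^sup>2 + (Im f)\<^sup>2 > 0"
    using assms by (metis complex_neq_0)
  thus ?thesis by (simp add: Re_divide zero_less_divide_iff)
qed

section \<open>The values of an interval polynomial on the imaginary axis\<close>

lemma eval_jw_add: "eval_jw (p + q) \<omega> = eval_jw p \<omega> + eval_jw q \<omega>"
proof -
  have "map_poly complex_of_real (p + q) = map_poly complex_of_real p + map_poly complex_of_real q"
    by (rule poly_eqI) (simp add: coeff_map_poly)
  thus ?thesis by (simp add: eval_jw_def)
qed

lemma eval_jw_monom: "eval_jw (monom c r) \<omega> = complex_of_real c * (\<i> * complex_of_real \<omega>) ^ r"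
  by (simp add: eval_jw_def map_poly_monom poly_monom)

lemma eval_jw_sum: "eval_jw (\<Sum>i\<in>A. p i) \<omega> = (\<Sum>i\<in>A. eval_jw (p i) \<omega>)"
proof (induction A rule: infinite_finite_induct)
  case (insert i A)
  thus ?case by (simp add: eval_jw_add)
qed (simp_all add: eval_jw_def)

lemma eval_jw_uminus: "eval_jw p (- \<omega>) = cnj (eval_jw p \<omega>)"
  by (simp add: eval_jw_def poly_cnj map_poly_map_poly o_def)

lemma i_power_even: "\<i> ^ (2 * l) = (- 1) ^ l"
  by (simp add: power_mult)

lemma i_times_real_power_even:
  "even r \<Longrightarrow> (\<i> * complex_of_real \<omega>) ^ r = complex_of_real ((- 1) ^ (r div 2) * \<omega> ^ r)"
  by (elim evenE) (simp add: power_mult_distrib i_power_even)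

lemma i_times_real_power_odd:
  "odd r \<Longrightarrow> (\<i> * complex_of_real \<omega>) ^ r = \<i> * complex_of_real ((- 1) ^ (r div 2) * \<omega> ^ r)"
  by (elim oddE) (simp add: power_mult_distrib i_power_even)

lemma sum_even_odd:
  fixes h :: "nat \<Rightarrow> 'a :: comm_monoid_add"
  shows "(\<Sum>r\<le>d. h r) = (\<Sum>l | 2 * l \<le> d. h (2 * l)) + (\<Sum>l | 2 * l + 1 \<le> d. h (2 * l + 1))"
proof -
  have "{..d} = {r. r \<le> d \<and> even r} \<union> {r. r \<le> d \<and> odd r}" by auto
  hence "(\<Sum>r\<le>d. h r) = (\<Sum>r | r \<le> d \<and> even r. h r) + (\<Sum>r | r \<le> d \<and> odd r. h r)"
    by (simp, subst sum.union_disjoint) auto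
  moreover have "(\<Sum>r | r \<le> d \<and> even r. h r) = (\<Sum>l | 2 * l \<le> d. h (2 * l))"
    by (rule sum.reindex_bij_witness[of _ "\<lambda>l. 2 * l" "\<lambda>r. r div 2"]) auto
  moreover have "(\<Sum>r | r \<le> d \<and> odd r. h r) = (\<Sum>l | 2 * l + 1 \<le> d. h (2 * l + 1))"
    by (rule sum.reindex_bij_witness[of _ "\<lambda>l. 2 * l + 1" "\<lambda>r. r div 2"]) auto
  ultimately show ?thesis by simp
qed

lemma kharitonov_poly_eq_sum_monom:
  "kharitonov_poly lo hi d i k =
     (\<Sum>r\<le>d. monom (bound_alt lo hi (if even r then i else k) (r div 2) r) r)"
  unfolding kharitonov_poly_def alpha_poly_def beta_poly_def pcompose_sum pcompose_monom_monom
    sum_distrib_left sum_even_odd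
  by (simp add: mult_monom)

text \<open>For \<open>\<omega> \<ge> 0\<close> these are the lower (index 1) and upper (index 2) ends of the sides of the
  rectangle of values. The bounds with the wrong parity of \<open>r\<close> are harmless, as the power of
  \<open>\<i> \<omega>\<close> then has vanishing real, respectively imaginary, part.\<close>

definition re_end :: "(nat \<Rightarrow> real) \<Rightarrow> (nat \<Rightarrow> real) \<Rightarrow> nat \<Rightarrow> real \<Rightarrow> nat \<Rightarrow> real" where
  "re_end lo hi d \<omega> i = (\<Sum>r\<le>d. bound_alt lo hi i (r div 2) r * Re ((\<i> * complex_of_real \<omega>) ^ r))"

definition im_end :: "(nat \<Rightarrow> real) \<Rightarrow> (nat \<Rightarrow> real) \<Rightarrow> nat \<Rightarrow> real \<Rightarrow> nat \<Rightarrow> real" where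
  "im_end lo hi d \<omega> k = (\<Sum>r\<le>d. bound_alt lo hi k (r div 2) r * Im ((\<i> * complex_of_real \<omega>) ^ r))"

lemma eval_jw_kharitonov_poly:
  "eval_jw (kharitonov_poly lo hi d i k) \<omega> = Complex (re_end lo hi d \<omega> i) (im_end lo hi d \<omega> k)"
  unfolding kharitonov_poly_eq_sum_monom eval_jw_sum eval_jw_monom re_end_def im_end_def
  by (rule complex_eqI)
    (auto intro!: sum.cong simp: i_times_real_power_even i_times_real_power_odd
      simp del: of_real_mult of_real_power)

text \<open>
  The sign \<open>(- 1) ^ l\<close> of the powers of \<open>\<i>\<close> is what the alternation in \<open>bound_alt\<close> compensates.
\<close>

lemma bound_alt_extremal:
  fixes w c :: real
  assumes "lo r \<le> c" "c \<le> hi r" "w \<ge> 0"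
  shows "bound_alt lo hi 1 l r * ((- 1) ^ l * w) \<le> c * ((- 1) ^ l * w)"
    and "c * ((- 1) ^ l * w) \<le> bound_alt lo hi 2 l r * ((- 1) ^ l * w)"
  using assms by (auto simp: bound_alt_def mult_right_mono)

lemma eval_jw_bounds:
  assumes "p \<in> interval_polys lo hi d" "\<omega> \<ge> 0"
  shows "Re (eval_jw p \<omega>) \<in> {re_end lo hi d \<omega> 1..re_end lo hi d \<omega> 2}"
    and "Im (eval_jw p \<omega>) \<in> {im_end lo hi d \<omega> 1..im_end lo hi d \<omega> 2}"
proof -
  obtain c where p: "p = (\<Sum>i\<le>d. monom (c i) i)" and c: "\<forall>i\<le>d. c i \<in> {lo i..hi i}"
    using assms(1) by (auto simp: interval_polys_def)
  have Re: "Re (eval_jw p \<omega>) = (\<Sum>r\<le>d. c r * Re ((\<i> * complex_of_real \<omega>) ^ r))"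
    and Im: "Im (eval_jw p \<omega>) = (\<Sum>r\<le>d. c r * Im ((\<i> * complex_of_real \<omega>) ^ r))"
    by (simp_all add: p eval_jw_sum eval_jw_monom)
  have re: "Re ((\<i> * complex_of_real \<omega>) ^ r) = (- 1) ^ (r div 2) * (if even r then \<omega> ^ r else 0)"
    and im: "Im ((\<i> * complex_of_real \<omega>) ^ r) = (- 1) ^ (r div 2) * (if odd r then \<omega> ^ r else 0)"
    for r
    by (auto simp: i_times_real_power_even i_times_real_power_odd
      simp del: of_real_mult of_real_power)
  show "Re (eval_jw p \<omega>) \<in> {re_end lo hi d \<omega> 1..re_end lo hi d \<omega> 2}"
    unfolding Re re_end_def re atLeastAtMost_iff
    by (intro conjI sum_mono bound_alt_extremal) (use c assms(2) in auto)
  show "Im (eval_jw p \<omega>) \<in> {im_end lo hi d \<omega> 1..im_end lo hi d \<omega> 2}"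
    unfolding Im im_end_def im atLeastAtMost_iff
    by (intro conjI sum_mono bound_alt_extremal) (use c assms(2) in auto)
qed

lemma convex_eval_jw_interval_polys: "convex ((\<lambda>p. eval_jw p \<omega>) ` interval_polys lo hi d)"
proof (rule convexI)
  fix z z' s t
  assume "z \<in> (\<lambda>p. eval_jw p \<omega>) ` interval_polys lo hi d"
    "z' \<in> (\<lambda>p. eval_jw p \<omega>) ` interval_polys lo hi d"
    and st: "(0::real) \<le> s" "0 \<le> t" "s + t = 1"
  then obtain c c' where c: "\<forall>i\<le>d. c i \<in> {lo i..hi i}" "\<forall>i\<le>d. c' i \<in> {lo i..hi i}"
    and z: "z = eval_jw (\<Sum>i\<le>d. monom (c i) i) \<omega>" "z' = eval_jw (\<Sum>i\<le>d. monom (c' i) i) \<omega>"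
    by (auto simp: interval_polys_def)
  have "s *\<^sub>R z + t *\<^sub>R z' = eval_jw (\<Sum>i\<le>d. monom (s * c i + t * c' i) i) \<omega>"
    by (simp add: z eval_jw_sum eval_jw_monom scaleR_conv_of_real sum_distrib_left
        sum.distrib algebra_simps)
  moreover have "\<forall>i\<le>d. s * c i + t * c' i \<in> {lo i..hi i}"
    using convexD[OF convex_real_interval(5)] c st by (metis real_scaleR_def)
  ultimately show "s *\<^sub>R z + t *\<^sub>R z' \<in> (\<lambda>p. eval_jw p \<omega>) ` interval_polys lo hi d"
    by (auto simp: interval_polys_def)
qed

text \<open>A point of the rectangle lies on a vertical segment between two points of the horizontal sides,
  and these lie between corners.\<close>

lemma cbox_subset_of_corners:
  fixes A :: "complex set"
  assumes "convex A"
    and "Complex x1 y1 \<in> A" "Complex x2 y1 \<in> A" "Complex x1 y2 \<in> A" "Complex x2 y2 \<in> A"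
  shows "cbox (Complex x1 y1) (Complex x2 y2) \<subseteq> A"
proof
  fix z assume z: "z \<in> cbox (Complex x1 y1) (Complex x2 y2)"
  hence "Re z \<in> closed_segment x1 x2" "Im z \<in> closed_segment y1 y2"
    by (auto simp: in_cbox_complex_iff closed_segment_eq_real_ivl)
  then obtain s t where s: "0 \<le> s" "s \<le> 1" "Re z = (1 - s) * x1 + s * x2"
    and t: "0 \<le> t" "t \<le> 1" "Im z = (1 - t) * y1 + t * y2"
    by (auto simp: closed_segment_def)
  have "(1 - s) *\<^sub>R Complex x1 y + s *\<^sub>R Complex x2 y \<in> A" if "y = y1 \<or> y = y2" for y
    by (rule convexD[OF assms(1)]) (use that assms s in auto)
  moreover have "(1 - s) *\<^sub>R Complex x1 y + s *\<^sub>R Complex x2 y = Complex (Re z) y" for y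
    by (rule complex_eqI) (simp_all add: s(3) algebra_simps)
  ultimately have "Complex (Re z) y1 \<in> A" "Complex (Re z) y2 \<in> A"
    by metis+
  hence "(1 - t) *\<^sub>R Complex (Re z) y1 + t *\<^sub>R Complex (Re z) y2 \<in> A"
    by (intro convexD[OF assms(1)]) (use t in auto)
  also have "(1 - t) *\<^sub>R Complex (Re z) y1 + t *\<^sub>R Complex (Re z) y2 = z"
    by (rule complex_eqI) (simp_all add: t(3) algebra_simps)
  finally show "z \<in> A" .
qed

text \<open>
  The rectangle is filled because the coefficient box is convex and evaluation is linear.
\<close>

lemma eval_jw_interval_polys:
  assumes "\<forall>i\<le>d. lo i \<le> hi i" "\<omega> \<ge> 0"
  shows "(\<lambda>p. eval_jw p \<omega>) ` interval_polys lo hi d =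
    cbox (Complex (re_end lo hi d \<omega> 1) (im_end lo hi d \<omega> 1))
         (Complex (re_end lo hi d \<omega> 2) (im_end lo hi d \<omega> 2))"
proof
  show "(\<lambda>p. eval_jw p \<omega>) ` interval_polys lo hi d \<subseteq>
    cbox (Complex (re_end lo hi d \<omega> 1) (im_end lo hi d \<omega> 1))
         (Complex (re_end lo hi d \<omega> 2) (im_end lo hi d \<omega> 2))"
    using eval_jw_bounds[OF _ assms(2)] by (fastforce simp: in_cbox_complex_iff)
  have "Complex (re_end lo hi d \<omega> i) (im_end lo hi d \<omega> k)
      \<in> (\<lambda>p. eval_jw p \<omega>) ` interval_polys lo hi d" for i k
    using kharitonov_poly_in_interval_polys[OF assms(1), of i k]
    by (force simp flip: eval_jw_kharitonov_poly)
  thus "cbox (Complex (re_end lo hi d \<omega> 1) (im_end lo hi d \<omega> 1))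
         (Complex (re_end lo hi d \<omega> 2) (im_end lo hi d \<omega> 2))
      \<subseteq> (\<lambda>p. eval_jw p \<omega>) ` interval_polys lo hi d"
    by (intro cbox_subset_of_corners convex_eval_jw_interval_polys)
qed

section \<open>Reduction of the frequency response to rectangles\<close>

lemma eval_jw_abs:
  shows "eval_jw p \<bar>\<omega>\<bar> = 0 \<longleftrightarrow> eval_jw p \<omega> = 0"
    and "Re (eval_jw g \<bar>\<omega>\<bar> / eval_jw f \<bar>\<omega>\<bar>) = Re (eval_jw g \<omega> / eval_jw f \<omega>)"
  by (auto simp: abs_if eval_jw_uminus Re_divide)

lemma quotient_attains_min:
  fixes G F :: "complex set"
  assumes "compact G" "compact F" "G \<noteq> {}" "F \<noteq> {}" "0 \<notin> F"
  shows "\<exists>g\<in>G. \<exists>f\<in>F. \<forall>g'\<in>G. \<forall>f'\<in>F. Re (g / f) \<le> Re (g' / f')"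
proof -
  have "continuous_on (G \<times> F) (\<lambda>z. Re (fst z / snd z))"
    using assms(5) by (intro continuous_intros) auto
  hence "\<exists>z\<in>G \<times> F. \<forall>z'\<in>G \<times> F. Re (fst z / snd z) \<le> Re (fst z' / snd z')"
    using assms by (intro continuous_attains_inf compact_Times) auto
  thus ?thesis by auto
qed

theorem theorem2:
  fixes m n :: nat
    and a_lo a_hi b_lo b_hi :: "nat \<Rightarrow> real"
    and \<omega> :: real
  assumes "m \<le> n"
    and "\<forall>i\<le>m. a_lo i \<le> a_hi i"
    and "\<forall>i\<le>n. b_lo i \<le> b_hi i"
    and "0 \<notin> {eval_jw f \<omega> | f. f \<in> interval_polys b_lo b_hi n}"
  defines "S \<equiv> {Re (eval_jw g \<omega> / eval_jw f \<omega>) | g f.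
      g \<in> interval_polys a_lo a_hi m \<and> f \<in> interval_polys b_lo b_hi n}"
  shows "(\<exists>\<mu>\<in>S. \<forall>x\<in>S. \<mu> \<le> x) \<and>
    ((LEAST x. x \<in> S) > 0 \<longleftrightarrow>
      Min {Re (eval_jw (kharitonov_poly a_lo a_hi m i1 j1) \<omega> /
               eval_jw (kharitonov_poly b_lo b_hi n i2 j2) \<omega>)
           | i1 j1 i2 j2. (i1, j1, i2, j2) \<in> I2} > 0)"
proof -
  define G where "G = (\<lambda>p. eval_jw p \<bar>\<omega>\<bar>) ` interval_polys a_lo a_hi m"
  define F where "F = (\<lambda>p. eval_jw p \<bar>\<omega>\<bar>) ` interval_polys b_lo b_hi n"
  define x y where "x = re_end a_lo a_hi m \<bar>\<omega>\<bar>" and "y = im_end a_lo a_hi m \<bar>\<omega>\<bar>"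
  define u v where "u = re_end b_lo b_hi n \<bar>\<omega>\<bar>" and "v = im_end b_lo b_hi n \<bar>\<omega>\<bar>"
  define q where "q i1 j1 i2 j2 = Re (Complex (x i1) (y j1) / Complex (u i2) (v j2))"
    for i1 j1 i2 j2
  have G: "G = cbox (Complex (x 1) (y 1)) (Complex (x 2) (y 2))"
    and F: "F = cbox (Complex (u 1) (v 1)) (Complex (u 2) (v 2))"
    using assms(2,3) by (simp_all add: G_def F_def x_def y_def u_def v_def eval_jw_interval_polys)
  have cornerG: "Complex (x i) (y k) \<in> G" and cornerF: "Complex (u i) (v k) \<in> F" for i k
    using kharitonov_poly_in_interval_polys assms(2,3)
    by (auto simp: G_def F_def x_def y_def u_def v_def simp flip: eval_jw_kharitonov_poly)
  have F0: "0 \<notin> F"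
    using assms(4) by (auto simp: F_def eval_jw_abs)
  have S: "S = {Re (g / f) | g f. g \<in> G \<and> f \<in> F}"
    unfolding S_def G_def F_def eval_jw_abs(2)[of _ \<omega>, symmetric] by auto

  have "compact G" "compact F"
    by (simp_all add: G F compact_cbox)
  moreover have "G \<noteq> {}" "F \<noteq> {}"
    using cornerG cornerF by blast+
  ultimately obtain g f where gf: "g \<in> G" "f \<in> F" "\<forall>g'\<in>G. \<forall>f'\<in>F. Re (g / f) \<le> Re (g' / f')"
    using quotient_attains_min[OF _ _ _ _ F0] by metis
  obtain \<mu> where \<mu>: "\<mu> \<in> S" "\<And>x. x \<in> S \<Longrightarrow> \<mu> \<le> x"
    using that[of "Re (g / f)"] gf unfolding S by blast
  have "(LEAST x. x \<in> S) = \<mu>"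
    by (rule Least_equality) (use \<mu> in auto)
  hence "(LEAST x. x \<in> S) > 0 \<longleftrightarrow> (\<forall>x\<in>S. x > 0)"
    using \<mu> by (auto intro: less_le_trans)
  also have "\<dots> \<longleftrightarrow> (\<forall>(i1, j1, i2, j2)\<in>I2. q i1 j1 i2 j2 > 0)"
  proof
    assume "\<forall>x\<in>S. x > 0"
    thus "\<forall>(i1, j1, i2, j2)\<in>I2. q i1 j1 i2 j2 > 0"
      using cornerG cornerF unfolding q_def S by blast
  next
    assume R: "\<forall>(i1, j1, i2, j2)\<in>I2. q i1 j1 i2 j2 > 0"
    have I2: "x i1 * u i2 + y j1 * v j2 > 0" if "(i1, j1, i2, j2) \<in> I2" for i1 j1 i2 j2
    proof -
      have "Complex (u i2) (v j2) \<noteq> 0" using cornerF F0 by metis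
      thus ?thesis using R that Re_divide_pos_iff unfolding q_def by fastforce
    qed
    have "u 1 \<le> u 2" "v 1 \<le> v 2"
      using cornerF[of 1 1] by (auto simp: F in_cbox_complex_iff)
    hence avoid: "0 < u 1 \<or> u 2 < 0 \<or> 0 < v 1 \<or> v 2 < 0"
      using F0 by (auto simp: F in_cbox_complex_iff not_le)
    show "\<forall>x\<in>S. x > 0"
    proof
      fix s assume "s \<in> S"
      then obtain g f where gf: "g \<in> G" "f \<in> F" and s: "s = Re (g / f)" by (auto simp: S)
      have "Re g * Re f + Im g * Im f > 0"
        by (rule inner_pos_of_I2_pairs[OF I2 avoid])
          (use gf in \<open>auto simp: G F in_cbox_complex_iff\<close>)
      moreover have "f \<noteq> 0" using gf F0 by auto
      ultimately show "s > 0" using Re_divide_pos_iff s by blast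
    qed
  qed
  also have "\<dots> \<longleftrightarrow> Min {q i1 j1 i2 j2 | i1 j1 i2 j2. (i1, j1, i2, j2) \<in> I2} > 0"
  proof -
    have "{q i1 j1 i2 j2 | i1 j1 i2 j2. (i1, j1, i2, j2) \<in> I2} =
        (\<lambda>(i1, j1, i2, j2). q i1 j1 i2 j2) ` I2"
      by force
    moreover have "finite I2" "I2 \<noteq> {}" by (simp_all add: I2_def)
    ultimately show ?thesis by (auto simp: Min_gr_iff)
  qed
  also have "q = (\<lambda>i1 j1 i2 j2. Re (eval_jw (kharitonov_poly a_lo a_hi m i1 j1) \<omega> /
      eval_jw (kharitonov_poly b_lo b_hi n i2 j2) \<omega>))"
    unfolding eval_jw_abs(2)[of _ \<omega>, symmetric]
    unfolding eval_jw_kharitonov_poly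
    by (simp add: fun_eq_iff q_def x_def y_def u_def v_def)
  finally show ?thesis using \<mu> by blast
qed

end
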